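(* Let $n\in\mathbb{N}$ and let $s=(s_\alpha)_{\alpha\in\mathbb{N}_0^n}$ be an indeterminate moment sequence. Then $\mathfrak{p}_s(t)$ is indeterminate for all $t\in[0,\infty)$.
   Context: A real sequence $s=(s_\alpha)_{\alpha\in\mathbb{N}_0^n}$ is a moment sequence if there is a positive Borel measure $\mu$ on $\mathbb{R}^n$ with all polynomials $\mu$-integrable such that $s_\alpha=\int_{\mathbb{R}^n}x^\alpha\,d\mu(x)$ for all $\alpha$; such $\mu$ is called a representing measure of $s$. A moment sequence is determinate if it has exactly one representing measure, and indeterminate otherwise (i.e. if it has at least two). For any real sequence $s=(s_\alpha)_{\alpha\in\mathbb{N}_0^n}$, $\mathfrak{p}_s(t)=(\mathfrak{p}_{s,\alpha}(t))_{\alpha\in\mathbb{N}_0^n}$, $t\in\mathbb{R}$, is the family of polynomials in $t$ uniquely determined recursively by $$\mathfrak{p}_{s,\alpha}(0)=s_\alpha,\qquad \frac{d}{dt}\mathfrak{p}_{s,\alpha}(t)=\sum_{j=1}^n\alpha_j(\alpha_j-1)\,\mathfrak{p}_{s,\alpha-2e_j}(t),$$ where $e_j$ is the $j$-th unit vector and terms with $\alpha_j\le 1$ are $0$ (evolution of moments under $\partial_tu=\Delta u$). *)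

theory Defs
  imports "HOL-Analysis.Analysis" "HOL-Computational_Algebra.Polynomial"
begin

text \<open>Multi-indices are functions \<open>'n \<Rightarrow> nat\<close> on a finite index type, so that the dimension is
  \<open>n = CARD('n) \<ge> 1\<close>; a sequence indexed by multi-indices has type \<open>('n \<Rightarrow> nat) \<Rightarrow> real\<close>.\<close>

definition monomial :: "('n::finite \<Rightarrow> nat) \<Rightarrow> real ^ 'n \<Rightarrow> real" where
  "monomial \<alpha> x = (\<Prod>j\<in>UNIV. (x $ j) ^ \<alpha> j)"

definition representing_measure ::
    "(('n::finite \<Rightarrow> nat) \<Rightarrow> real) \<Rightarrow> (real ^ 'n) measure \<Rightarrow> bool" where
  "representing_measure s M \<longleftrightarrow>
     sets M = sets borel \<and>
     (\<forall>p. real_polynomial_function p \<longrightarrow> integrable M p) \<and>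
     (\<forall>\<alpha>. s \<alpha> = (LINT x|M. monomial \<alpha> x))"

definition moment_sequence :: "(('n::finite \<Rightarrow> nat) \<Rightarrow> real) \<Rightarrow> bool" where
  "moment_sequence s \<longleftrightarrow> (\<exists>M. representing_measure s M)"

definition determinate :: "(('n::finite \<Rightarrow> nat) \<Rightarrow> real) \<Rightarrow> bool" where
  "determinate s \<longleftrightarrow> (\<exists>!M. representing_measure s M)"

definition indeterminate :: "(('n::finite \<Rightarrow> nat) \<Rightarrow> real) \<Rightarrow> bool" where
  "indeterminate s \<longleftrightarrow> moment_sequence s \<and> \<not> determinate s"

text \<open>The multi-index \<open>\<alpha> - 2 e\<^sub>j\<close> is \<open>\<alpha>(j := \<alpha> j - 2)\<close>. The subtractions on \<open>nat\<close> are harmless: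
  for \<open>\<alpha> j \<le> 1\<close> the factor \<open>\<alpha> j * (\<alpha> j - 1)\<close> is \<open>0\<close>, so the term vanishes as required.\<close>

definition heat_moment_family ::
    "(('n::finite \<Rightarrow> nat) \<Rightarrow> real) \<Rightarrow> (('n \<Rightarrow> nat) \<Rightarrow> real poly) \<Rightarrow> bool" where
  "heat_moment_family s p \<longleftrightarrow>
     (\<forall>\<alpha>. poly (p \<alpha>) 0 = s \<alpha> \<and>
          pderiv (p \<alpha>) = (\<Sum>j\<in>UNIV. smult (real (\<alpha> j * (\<alpha> j - 1))) (p (\<alpha>(j := \<alpha> j - 2)))))"

text \<open>Existence and uniqueness of the family (\<open>heat_moment_family_ex1\<close>) is proved below.\<close>

definition heat_moment_poly :: "(('n::finite \<Rightarrow> nat) \<Rightarrow> real) \<Rightarrow> ('n \<Rightarrow> nat) \<Rightarrow> real poly" where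
  "heat_moment_poly s = (THE p. heat_moment_family s p)"

definition heat_moments ::
    "(('n::finite \<Rightarrow> nat) \<Rightarrow> real) \<Rightarrow> real \<Rightarrow> ('n \<Rightarrow> nat) \<Rightarrow> real" where
  "heat_moments s t \<alpha> = poly (heat_moment_poly s \<alpha>) t"

lemma pderiv_sum: "pderiv (sum f A) = (\<Sum>i\<in>A. pderiv (f i))"
  using higher_pderiv_sum[of 1 f A] by simp

lemma ex_antideriv: "\<exists>P. pderiv P = q \<and> poly P 0 = c" for q :: "real poly"
proof -
  define P where "P = [:c:] + (\<Sum>i\<le>degree q. monom (coeff q i / real (Suc i)) (Suc i))"
  have "pderiv P = (\<Sum>i\<le>degree q. monom (coeff q i) i)"
    by (simp add: P_def pderiv_add pderiv_sum pderiv_monom pderiv_pCons del: of_nat_Suc)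
  moreover have "\<dots> = q" by (rule poly_as_sum_of_monoms)
  moreover have "poly P 0 = c" by (simp add: P_def poly_sum poly_monom)
  ultimately show ?thesis by metis
qed

lemma sum_fun_upd_less:
  fixes \<alpha> :: "'n::finite \<Rightarrow> nat"
  assumes "2 \<le> \<alpha> j"
  shows "(\<Sum>i\<in>UNIV. (\<alpha>(j := \<alpha> j - 2)) i) < (\<Sum>i\<in>UNIV. \<alpha> i)"
  by (rule sum_strict_mono_ex1) (use assms in \<open>auto intro!: bexI[of _ j]\<close>)

function heat_rec :: "(('n::finite \<Rightarrow> nat) \<Rightarrow> real) \<Rightarrow> ('n \<Rightarrow> nat) \<Rightarrow> real poly" where
  "heat_rec s \<alpha> = (SOME P. poly P 0 = s \<alpha> \<and> pderiv P =
     (\<Sum>j\<in>UNIV. if 2 \<le> \<alpha> j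
        then smult (real (\<alpha> j * (\<alpha> j - 1))) (heat_rec s (\<alpha>(j := \<alpha> j - 2))) else 0))"
  by pat_completeness auto
termination
  by (relation "Wellfounded.measure (\<lambda>(s, \<alpha>). \<Sum>i\<in>UNIV. \<alpha> i)") (use sum_fun_upd_less in auto)

declare heat_rec.simps [simp del]

lemma heat_rec_family: "heat_moment_family s (heat_rec s)"
proof -
  have rec: "poly (heat_rec s \<alpha>) 0 = s \<alpha> \<and> pderiv (heat_rec s \<alpha>) =
     (\<Sum>j\<in>UNIV. if 2 \<le> \<alpha> j
        then smult (real (\<alpha> j * (\<alpha> j - 1))) (heat_rec s (\<alpha>(j := \<alpha> j - 2))) else 0)" for \<alpha>
    unfolding heat_rec.simps[of s \<alpha>] by (rule someI_ex) (use ex_antideriv in blast)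
  have cut: "(if 2 \<le> a then smult (real (a * (a - 1))) q else 0) = smult (real (a * (a - 1))) q"
    for a :: nat and q :: "real poly"
    using less_2_cases_iff[of a] by auto
  show ?thesis
    using rec unfolding heat_moment_family_def cut by blast
qed

lemma heat_moment_family_unique:
  assumes p: "heat_moment_family s p" and q: "heat_moment_family s q"
  shows "p = q"
proof
  fix \<alpha>
  show "p \<alpha> = q \<alpha>"
  proof (induction "\<Sum>i\<in>UNIV. \<alpha> i" arbitrary: \<alpha> rule: less_induct)
    case less
    have "smult (real (\<alpha> j * (\<alpha> j - 1))) (p (\<alpha>(j := \<alpha> j - 2))) =
          smult (real (\<alpha> j * (\<alpha> j - 1))) (q (\<alpha>(j := \<alpha> j - 2)))" for j
    proof (cases "2 \<le> \<alpha> j")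
      case True
      show ?thesis by (simp only: less[OF sum_fun_upd_less[of \<alpha> j, OF True]])
    next
      case False
      then have "\<alpha> j = 0 \<or> \<alpha> j = 1" by auto
      then have "\<alpha> j * (\<alpha> j - 1) = 0" by auto
      then show ?thesis by (simp only: of_nat_0 smult_0_left)
    qed
    then have "pderiv (p \<alpha>) = pderiv (q \<alpha>)"
      using p q by (simp only: heat_moment_family_def)
    then have "pderiv (p \<alpha> - q \<alpha>) = 0" by (simp add: pderiv_diff)
    then obtain c where c: "p \<alpha> - q \<alpha> = [:c:]"
      using pderiv_iszero by blast
    have "poly (p \<alpha> - q \<alpha>) 0 = 0"
      using p q by (simp add: heat_moment_family_def)
    then show ?case using c by simp
  qed
qed

lemma heat_moment_family_ex1: "\<exists>!p. heat_moment_family s p"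
  using heat_rec_family heat_moment_family_unique by blast

lemma heat_moment_family_poly: "heat_moment_family s (heat_moment_poly s)"
  unfolding heat_moment_poly_def by (rule theI'[where P = "heat_moment_family s", OF heat_moment_family_ex1])

end

theory Submission
  imports Defs "HOL-Probability.Characteristic_Functions"
begin

text \<open>If \<open>M\<close> represents \<open>s\<close>, then its evolution under the heat flow, the law of \<open>x + sqrt (2 * t) *\<^sub>R z\<close>
  with \<open>x\<close> distributed as \<open>M\<close> and \<open>z\<close> an independent standard Gaussian vector, represents
  \<open>heat_moments s t\<close>: the Gaussian averages of the monomials are the heat polynomials, which solve the
  recursion pointwise in \<open>x\<close>. So it suffices that the heat flow is injective on finite measures. It multiplies
  the integral of \<open>cos (a \<bullet> x + b)\<close> by \<open>exp (- t * (norm a)\<^sup>2) \<noteq> 0\<close>, and these integrals determine a finite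
  measure: a polynomial in the coordinates \<open>L * sin (x\<^sub>b / L)\<close> is a trigonometric polynomial, so
  by Weierstrass approximation the integrals of \<open>f (L * sin (x / L))\<close> are determined for every bounded
  continuous \<open>f\<close>, and \<open>L \<longlongrightarrow> \<infinity>\<close> gives the integral of \<open>f\<close>.\<close>

subsection \<open>Trigonometric integrals determine a finite measure\<close>

text \<open>The phase \<open>b\<close> turns constants and sines into instances of the one base
  rule, so real integrals of shifted cosines are enough and no complex exponentials enter.\<close>

inductive trig_poly :: "('a::real_inner \<Rightarrow> real) \<Rightarrow> bool" where
  cos: "trig_poly (\<lambda>x. c * cos (a \<bullet> x + b))"
| add: "trig_poly f \<Longrightarrow> trig_poly g \<Longrightarrow> trig_poly (\<lambda>x. f x + g x)"

lemma trig_poly_const: "trig_poly (\<lambda>x. c)"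
  using trig_poly.cos[of c 0 0] by simp

lemma trig_poly_sin: "trig_poly (\<lambda>x. c * sin (a \<bullet> x))"
  using trig_poly.cos[of c a "- (pi / 2)"] by (simp add: cos_diff)

text \<open>Two cosines multiply by the product-to-sum formula, which adds and subtracts frequencies
  and phases; distributivity does the rest.\<close>

lemma trig_poly_mult:
  assumes "trig_poly f" and "trig_poly g"
  shows "trig_poly (\<lambda>x. f x * g x)"
  using assms
proof (induction f rule: trig_poly.induct)
  case f: (cos c a b)
  from f show ?case
  proof (induction g rule: trig_poly.induct)
    case (cos c' a' b')
    have "(\<lambda>x. c * cos (a \<bullet> x + b) * (c' * cos (a' \<bullet> x + b'))) =
        (\<lambda>x. (c * c' / 2) * cos ((a - a') \<bullet> x + (b - b')) + (c * c' / 2) * cos ((a + a') \<bullet> x + (b + b')))"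
    proof
      fix x
      have *: "(a - a') \<bullet> x + (b - b') = (a \<bullet> x + b) - (a' \<bullet> x + b')"
        "(a + a') \<bullet> x + (b + b') = (a \<bullet> x + b) + (a' \<bullet> x + b')"
        by (simp_all add: inner_simps)
      show "c * cos (a \<bullet> x + b) * (c' * cos (a' \<bullet> x + b')) =
        (c * c' / 2) * cos ((a - a') \<bullet> x + (b - b')) + (c * c' / 2) * cos ((a + a') \<bullet> x + (b + b'))"
        unfolding * cos_add cos_diff by (simp add: field_simps)
    qed
    then show ?case
      by (simp only:) (intro trig_poly.add trig_poly.cos)
  next
    case (add g h)
    then show ?case
      unfolding distrib_left by (intro trig_poly.add)
  qed
next
  case (add f h)
  then show ?case
    unfolding distrib_right by (intro trig_poly.add)
qed

lemma trig_poly_sum: "finite I \<Longrightarrow> (\<And>i. i \<in> I \<Longrightarrow> trig_poly (f i)) \<Longrightarrow> trig_poly (\<lambda>x. \<Sum>i\<in>I. f i x)"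
proof (induction I rule: finite_induct)
  case empty
  show ?case unfolding sum.empty by (rule trig_poly_const)
next
  case (insert i I)
  then have "trig_poly (\<lambda>x. f i x + (\<Sum>i\<in>I. f i x))"
    by (intro trig_poly.add) auto
  with insert.hyps show ?case by simp
qed

section \<open>Trigonometric approximation of the identity map\<close>

definition sine_map :: "real \<Rightarrow> 'a::euclidean_space \<Rightarrow> 'a" where
  "sine_map L x = (\<Sum>b\<in>Basis. (L * sin ((x \<bullet> b) / L)) *\<^sub>R b)"

text \<open>Induction on the polynomial: composed with \<open>sine_map L\<close>, a linear
  functional becomes a finite combination of sines, and trigonometric polynomials contain the
  constants and are closed under sums and products.\<close>

lemma trig_poly_sine_map:
  assumes "real_polynomial_function p"
  shows "trig_poly (\<lambda>x. p (sine_map L x))"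
  using assms
proof (induction p rule: real_polynomial_function.induct)
  case (linear f)
  then interpret bounded_linear f .
  have "(\<lambda>x. f (sine_map L x)) = (\<lambda>x. \<Sum>b\<in>Basis. (L * f b) * sin ((b /\<^sub>R L) \<bullet> x))"
    by (simp add: sine_map_def sum scaleR inner_commute divide_inverse mult_ac)
  then show ?case
    by (simp only:) (intro trig_poly_sum trig_poly_sin finite_Basis)
qed (simp_all only: trig_poly_const trig_poly.add trig_poly_mult)

lemma sine_map_tendsto: "(\<lambda>n. sine_map (real (Suc n)) x) \<longlonglongrightarrow> x"
proof -
  have "(\<lambda>n. real (Suc n) * sin (y / real (Suc n))) \<longlonglongrightarrow> y" for y
  proof (cases "y = 0")
    case False
    have "((\<lambda>h. sin h / h) \<longlongrightarrow> 1) (at (0::real))"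
      using DERIV_sin[of 0] by (simp add: has_field_derivative_iff)
    \<comment> \<open>The filter \<open>at 0\<close> excludes the point 0 itself, hence the separate
      case \<open>y = 0\<close>.\<close>
    moreover have "filterlim (\<lambda>n. y / real (Suc n)) (at 0) sequentially"
      unfolding filterlim_at using False LIMSEQ_Suc[OF lim_const_over_n[of y]] by (auto simp del: of_nat_Suc)
    ultimately have "(\<lambda>n. sin (y / real (Suc n)) / (y / real (Suc n))) \<longlonglongrightarrow> 1"
      by (rule filterlim_compose)
    then have "(\<lambda>n. y * (sin (y / real (Suc n)) / (y / real (Suc n)))) \<longlonglongrightarrow> y * 1"
      by (intro tendsto_intros)
    moreover have "y * (sin (y / real (Suc n)) / (y / real (Suc n))) = real (Suc n) * sin (y / real (Suc n))" for n
      using False by (simp del: of_nat_Suc)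
    ultimately show ?thesis by simp
  qed simp
  then have "(\<lambda>n. sine_map (real (Suc n)) x) \<longlonglongrightarrow> (\<Sum>b\<in>Basis. (x \<bullet> b) *\<^sub>R b)"
    unfolding sine_map_def by (intro tendsto_intros)
  then show ?thesis by (simp add: euclidean_representation)
qed

lemma sine_map_continuous: "continuous_on UNIV (sine_map L)"
  unfolding sine_map_def divide_inverse by (intro continuous_intros)

lemma sine_map_in_box:
  assumes "0 \<le> L"
  shows "sine_map L x \<in> cbox (- (L *\<^sub>R One)) (L *\<^sub>R One)"
proof -
  have "\<bar>L * sin y\<bar> \<le> L" for y
    using mult_left_mono[OF abs_sin_le_one[of y] assms] assms by (simp add: abs_mult)
  then have "- L \<le> L * sin y \<and> L * sin y \<le> L" for y
    by (simp add: abs_le_iff) (smt (verit))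
  then show ?thesis by (simp add: mem_box sine_map_def inner_minus_left)
qed

text \<open>Equality of the integrals is extended in stages: to trigonometric polynomials, to
  \<open>f (sine_map L x)\<close>, to bounded continuous \<open>f\<close>, and to indicators of
  closed sets. Each passage to a limit is dominated convergence with a constant bound, which is
  integrable because the measures are finite.\<close>

lemma finite_measure_eqI_cos:
  fixes M N :: "'a::euclidean_space measure"
  assumes "finite_measure M" "finite_measure N"
    and M [measurable_cong]: "sets M = sets borel" and N [measurable_cong]: "sets N = sets borel"
    and eq: "\<And>a b. (LINT x|M. cos (a \<bullet> x + b)) = (LINT x|N. cos (a \<bullet> x + b))"
  shows "M = N"
proof -
  interpret M: finite_measure M by fact
  interpret N: finite_measure N by fact
  have bounded_int: "integrable M f" "integrable N f"
    if "f \<in> borel_measurable borel" "\<And>x. \<bar>f x\<bar> \<le> B" for f :: "'a \<Rightarrow> real" and B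
    using that by (auto intro!: M.integrable_const_bound[where B = B] N.integrable_const_bound[where B = B]
        simp: measurable_cong_sets[OF M refl] measurable_cong_sets[OF N refl])
  have limit: "(LINT x|M. f x) = (LINT x|N. f x)"
    if f: "f \<in> borel_measurable borel" and F: "\<And>n. F n \<in> borel_measurable borel"
      and B: "\<And>n x. \<bar>F n x\<bar> \<le> B" and lim: "\<And>x. (\<lambda>n. F n x) \<longlonglongrightarrow> f x"
      and FE: "\<And>n. (LINT x|M. F n x) = (LINT x|N. F n x)"
    for f :: "'a \<Rightarrow> real" and F B
  proof -
    note [measurable] = f F
    have "(\<lambda>n. LINT x|M. F n x) \<longlonglongrightarrow> (LINT x|M. f x)"
      by (rule integral_dominated_convergence[where w = "\<lambda>_. B"]) (auto intro: B lim)
    moreover have "(\<lambda>n. LINT x|N. F n x) \<longlonglongrightarrow> (LINT x|N. f x)"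
      by (rule integral_dominated_convergence[where w = "\<lambda>_. B"]) (auto intro: B lim)
    ultimately show ?thesis
      unfolding FE by (rule LIMSEQ_unique)
  qed
  have trig: "integrable M f \<and> integrable N f \<and> (LINT x|M. f x) = (LINT x|N. f x)" if "trig_poly f" for f
    using that
  proof (induction f rule: trig_poly.induct)
    case (cos c a b)
    have "\<bar>c * cos (a \<bullet> x + b)\<bar> \<le> \<bar>c\<bar>" for x
      using mult_left_mono[OF abs_cos_le_one[of "a \<bullet> x + b"], of "\<bar>c\<bar>"] by (simp add: abs_mult)
    then show ?case
      by (intro conjI bounded_int[where B = "\<bar>c\<bar>"]) (auto simp: eq)
  qed auto
  have sine: "(LINT x|M. f (sine_map L x)) = (LINT x|N. f (sine_map L x))"
    if f: "continuous_on UNIV f" and B: "\<And>x. \<bar>f x\<bar> \<le> B" and L: "0 < L" for f :: "'a \<Rightarrow> real" and B L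
  proof -
    let ?K = "cbox (- (L *\<^sub>R One)) (L *\<^sub>R One) :: 'a set"
    \<comment> \<open>Weierstrass approximation is uniform only on the compact cube, and that
      suffices because \<open>sine_map L\<close> takes all its values there.\<close>
    have "\<exists>g. real_polynomial_function g \<and> (\<forall>x\<in>?K. \<bar>f x - g x\<bar> < 1 / real (Suc n))" for n
      by (rule Stone_Weierstrass_real_polynomial_function[of ?K f "1 / real (Suc n)"])
        (use continuous_on_subset[OF f] in auto)
    then obtain p where p: "\<And>n. real_polynomial_function (p n)"
      and pf: "\<And>n x. x \<in> ?K \<Longrightarrow> \<bar>f x - p n x\<bar> < 1 / real (Suc n)"
      by metis
    have pf': "\<bar>f (sine_map L x) - p n (sine_map L x)\<bar> < 1 / real (Suc n)" for n x
      using L by (intro pf sine_map_in_box) auto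
    show ?thesis
    \<comment> \<open>The extra 1 absorbs the approximation error, which is below
      \<open>1 / real (Suc n)\<close> and so below 1 for every \<open>n\<close>.\<close>
    proof (rule limit[where F = "\<lambda>n x. p n (sine_map L x)" and B = "B + 1"])
      show "(\<lambda>x. f (sine_map L x)) \<in> borel_measurable borel"
        by (intro borel_measurable_continuous_onI continuous_on_compose2[OF f sine_map_continuous]) auto
      show "(\<lambda>x. p n (sine_map L x)) \<in> borel_measurable borel" for n
        by (intro borel_measurable_continuous_onI continuous_on_compose2[OF _ sine_map_continuous]
            continuous_on_polymonial_function) (use p real_polynomial_function_eq in auto)
      show "\<bar>p n (sine_map L x)\<bar> \<le> B + 1" for n x
      proof -
        have "1 / real (Suc n) \<le> 1" by simp
        then show ?thesis using pf'[of x n] B[of "sine_map L x"] by linarith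
      qed
      show "(\<lambda>n. p n (sine_map L x)) \<longlonglongrightarrow> f (sine_map L x)" for x
      proof (rule LIM_zero_cancel, rule Lim_null_comparison)
        show "(\<lambda>n. 1 / real (Suc n)) \<longlonglongrightarrow> 0"
          by (rule LIMSEQ_Suc[OF lim_const_over_n])
        show "\<forall>\<^sub>F n in sequentially. norm (p n (sine_map L x) - f (sine_map L x)) \<le> 1 / real (Suc n)"
        proof (intro always_eventually allI)
          fix n
          show "norm (p n (sine_map L x) - f (sine_map L x)) \<le> 1 / real (Suc n)"
            using pf'[of x n] unfolding real_norm_def by linarith
        qed
      qed
      show "(LINT x|M. p n (sine_map L x)) = (LINT x|N. p n (sine_map L x))" for n
        using trig[OF trig_poly_sine_map[OF p, of n L]] by (elim conjE)
    qed
  qed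
  have cont: "(LINT x|M. f x) = (LINT x|N. f x)"
    if f: "continuous_on UNIV f" and B: "\<And>x. \<bar>f x\<bar> \<le> B" for f :: "'a \<Rightarrow> real" and B
  proof (rule limit[where F = "\<lambda>n x. f (sine_map (real (Suc n)) x)" and B = B])
    show "f \<in> borel_measurable borel"
      using f by (rule borel_measurable_continuous_onI)
    show "(\<lambda>x. f (sine_map (real (Suc n)) x)) \<in> borel_measurable borel" for n
      by (intro borel_measurable_continuous_onI continuous_on_compose2[OF f sine_map_continuous]) auto
    show "(\<lambda>n. f (sine_map (real (Suc n)) x)) \<longlonglongrightarrow> f x" for x
      by (rule continuous_on_tendsto_compose[OF f sine_map_tendsto]) auto
  qed (use B sine[OF f B] in auto)
  have closed_eq: "emeasure M F = emeasure N F" if F: "closed F" for F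
  \<comment> \<open>The empty set is separated because \<open>infdist x {}\<close> is 0 by
    convention, so the functions \<open>g n\<close> below would be constantly 1.\<close>
  proof (cases "F = {}")
    case False
    \<comment> \<open>These functions equal 1 on \<open>F\<close>; off \<open>F\<close> the distance
      is positive because \<open>F\<close> is closed, so they vanish once \<open>n\<close> is
      large.\<close>
    define g where "g n x = max 0 (1 - real n * infdist x F)" for n x
    have "(LINT x|M. indicator F x) = (LINT x|N. indicator F x :: real)"
    proof (rule limit[where F = g and B = 1])
      show "(indicator F :: 'a \<Rightarrow> real) \<in> borel_measurable borel"
        using F by simp
      have c: "continuous_on UNIV (g n)" for n
        unfolding g_def by (intro continuous_intros)
      then show "g n \<in> borel_measurable borel" for n
        by (rule borel_measurable_continuous_onI)
      show b: "\<bar>g n x\<bar> \<le> 1" for n x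
        by (simp add: g_def infdist_nonneg)
      show "(LINT x|M. g n x) = (LINT x|N. g n x)" for n
        by (rule cont[OF c b])
      show "(\<lambda>n. g n x) \<longlonglongrightarrow> indicator F x" for x
      proof (cases "x \<in> F")
        case True
        then show ?thesis by (simp add: g_def)
      next
        case notin: False
        then have pos: "0 < infdist x F"
          using infdist_pos_not_in_closed[OF F False] by simp
        obtain m :: nat where m: "1 < real m * infdist x F"
          using reals_Archimedean3[OF pos] by blast
        have "g n x = 0" if "m \<le> n" for n
        proof -
          have "real m * infdist x F \<le> real n * infdist x F"
            using that pos by (intro mult_right_mono) auto
          then show ?thesis using m by (simp add: g_def)
        qed
        then have "\<forall>\<^sub>F n in sequentially. g n x = 0"
          unfolding eventually_sequentially by blast
        then show ?thesis
          using notin by (simp add: tendsto_eventually)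
      qed
    qed
    then show ?thesis
      using F M N by (simp add: M.emeasure_eq_measure N.emeasure_eq_measure)
  qed simp
  show ?thesis
  \<comment> \<open>The whole space is itself closed and has finite measure, so a constant sequence
    serves as the exhausting cover.\<close>
  proof (rule measure_eqI_generator_eq[where \<Omega> = UNIV and E = "Collect closed" and A = "\<lambda>_. UNIV"])
    show "Int_stable (Collect closed :: 'a set set)"
      by (auto simp: Int_stable_def)
    show "sets M = sigma_sets UNIV (Collect closed)" "sets N = sigma_sets UNIV (Collect closed)"
      by (simp_all add: M N sets_measure_of borel_eq_closed)
  qed (auto simp: closed_eq)
qed

subsection \<open>The heat flow on measures\<close>

text \<open>Taking the image of a product measure builds in the independence of the coordinates, so
  integrals of coordinatewise products factor.\<close>

definition gauss_vec :: "(real ^ 'n::finite) measure" where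
  "gauss_vec = distr (PiM UNIV (\<lambda>_. std_normal_distribution)) borel (\<lambda>z. \<chi> j. z j)"

lemma sets_gauss_vec [simp, measurable_cong]: "sets gauss_vec = sets borel"
  by (simp add: gauss_vec_def)

lemma space_gauss_vec [simp]: "space gauss_vec = UNIV"
  by (simp add: gauss_vec_def)

lemma measurable_vec_lambda_PiM [measurable]:
  "(\<lambda>z. \<chi> j. z j) \<in> measurable (PiM UNIV (\<lambda>_::'n::finite. std_normal_distribution)) (borel :: (real ^ 'n) measure)"
proof -
  \<comment> \<open>As a finite combination of axis vectors, the map inherits measurability from its
    coordinates.\<close>
  have vec: "(\<lambda>z. \<chi> j. z j) = (\<lambda>z::'n \<Rightarrow> real. \<Sum>j\<in>UNIV. z j *\<^sub>R axis j 1)"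
    by (simp add: fun_eq_iff vec_eq_iff axis_def if_distrib cong: if_cong)
  have "(\<lambda>z. z j) \<in> borel_measurable (PiM UNIV (\<lambda>_::'n. std_normal_distribution))" for j
    using measurable_component_singleton[of j UNIV "\<lambda>_. std_normal_distribution"]
    by (simp add: measurable_cong_sets[OF refl sets_density])
  then show ?thesis
    unfolding vec by (intro borel_measurable_sum borel_measurable_scaleR) auto
qed

interpretation std_normal: prob_space std_normal_distribution
  by (rule prob_space_normal_density) simp

interpretation std_normal_product: product_prob_space "\<lambda>_. std_normal_distribution" UNIV
  by unfold_locales

interpretation gauss_vec: prob_space "gauss_vec :: (real ^ 'n::finite) measure"
  unfolding gauss_vec_def
  by (rule prob_space.prob_space_distr[OF prob_space_PiM measurable_vec_lambda_PiM]) unfold_locales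

lemma
  \<comment> \<open>The value type stays general: complex exponentials are needed for the
    characteristic function, real polynomials for weights and moments.\<close>
  fixes f :: "'n::finite \<Rightarrow> real \<Rightarrow> 'b::{real_normed_field, banach, second_countable_topology}"
  assumes f: "\<And>j. integrable std_normal_distribution (f j)"
  shows integrable_gauss_vec_prod: "integrable gauss_vec (\<lambda>z. \<Prod>j\<in>UNIV. f j (z $ j))"
    and integral_gauss_vec_prod:
      "(LINT z|gauss_vec. (\<Prod>j\<in>UNIV. f j (z $ j))) = (\<Prod>j\<in>UNIV. integral\<^sup>L std_normal_distribution (f j))"
proof -
  have [measurable]: "f j \<in> borel_measurable borel" for j
    using borel_measurable_integrable[OF f[of j]] by simp
  have meas: "(\<lambda>z. \<Prod>j\<in>UNIV. f j (z $ j)) \<in> borel_measurable (borel :: (real ^ 'n) measure)"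
    by measurable
  show "integrable gauss_vec (\<lambda>z. \<Prod>j\<in>UNIV. f j (z $ j))"
    unfolding gauss_vec_def integrable_distr_eq[OF measurable_vec_lambda_PiM meas]
    using std_normal_product.product_integrable_prod[of UNIV f] f by simp
  show "(LINT z|gauss_vec. (\<Prod>j\<in>UNIV. f j (z $ j))) = (\<Prod>j\<in>UNIV. integral\<^sup>L std_normal_distribution (f j))"
    unfolding gauss_vec_def integral_distr[OF measurable_vec_lambda_PiM meas]
    using std_normal_product.product_integral_prod[of UNIV f] f by simp
qed

text \<open>The characteristic function factors into one-dimensional Gaussian ones and is real.
  Multiplying it by \<open>iexp c\<close> and taking real parts leaves only
  \<open>cos c\<close>.\<close>

lemma integral_gauss_vec_cos:
  fixes a :: "real ^ 'n::finite"
  shows "(LINT z|gauss_vec. cos (c + a \<bullet> z)) = exp (- (norm a)\<^sup>2 / 2) * cos c"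
proof -
  have exp_prod: "iexp (a \<bullet> z) = (\<Prod>j\<in>UNIV. iexp (a $ j * z $ j))" for z :: "real ^ 'n"
    by (simp add: inner_vec_def sum_distrib_left exp_sum)
  have int1: "integrable std_normal_distribution (\<lambda>x. iexp (y * x))" for y
    by (rule std_normal.integrable_const_bound[where B = 1]) auto
  have int: "integrable gauss_vec (\<lambda>z. iexp (a \<bullet> z))"
    unfolding exp_prod by (rule integrable_gauss_vec_prod[OF int1])
  have "(CLINT z|gauss_vec. iexp (a \<bullet> z)) = (\<Prod>j\<in>UNIV. char std_normal_distribution (a $ j))"
    unfolding exp_prod char_def by (rule integral_gauss_vec_prod[OF int1])
  also have "\<dots> = complex_of_real (\<Prod>j\<in>UNIV. exp (- ((a $ j)\<^sup>2) / 2))"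
    by (simp add: char_std_normal_distribution)
  also have "(\<Prod>j\<in>UNIV. exp (- ((a $ j)\<^sup>2) / 2)) = exp (- (norm a)\<^sup>2 / 2)"
    unfolding power2_norm_eq_inner inner_vec_def
    by (simp add: power2_eq_square sum_negf flip: exp_sum sum_divide_distrib)
  finally have char: "(CLINT z|gauss_vec. iexp (a \<bullet> z)) = complex_of_real (exp (- (norm a)\<^sup>2 / 2))" .
  have "cos (c + a \<bullet> z) = Re (iexp c * iexp (a \<bullet> z))" for z
    by (simp add: exp_add[symmetric] distrib_left[symmetric] Re_exp)
  then have "(LINT z|gauss_vec. cos (c + a \<bullet> z)) = Re (CLINT z|gauss_vec. iexp c * iexp (a \<bullet> z))"
    using int by (simp only: integral_Re integrable_mult_right)
  also have "\<dots> = exp (- (norm a)\<^sup>2 / 2) * cos c"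
    unfolding integral_mult_right_zero char by (simp add: Re_exp)
  finally show ?thesis .
qed

text \<open>The heat kernel at time \<open>t\<close> is Gaussian with variance \<open>2 * t\<close> in each coordinate.\<close>

definition heat_measure :: "(real ^ 'n::finite) measure \<Rightarrow> real \<Rightarrow> (real ^ 'n) measure" where
  "heat_measure M t = distr (M \<Otimes>\<^sub>M gauss_vec) borel (\<lambda>(x, z). x + sqrt (2 * t) *\<^sub>R z)"

lemma sets_heat_measure [simp, measurable_cong]: "sets (heat_measure M t) = sets borel"
  by (simp add: heat_measure_def)

lemma measurable_heat_map:
  fixes M :: "(real ^ 'n::finite) measure"
  assumes [measurable_cong]: "sets M = sets borel"
  shows "(\<lambda>(x, z). x + r *\<^sub>R z) \<in> measurable (M \<Otimes>\<^sub>M gauss_vec) borel"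
  by measurable

lemma integrable_heat_measure_iff:
  fixes f :: "real ^ 'n::finite \<Rightarrow> real"
  assumes "sets M = sets borel" and "f \<in> borel_measurable borel"
  shows "integrable (heat_measure M t) f \<longleftrightarrow>
    integrable (M \<Otimes>\<^sub>M gauss_vec) (\<lambda>(x, z). f (x + sqrt (2 * t) *\<^sub>R z))"
  unfolding heat_measure_def integrable_distr_eq[OF measurable_heat_map[OF assms(1)] assms(2)]
  by (simp add: case_prod_unfold)

lemma integral_heat_measure:
  fixes f :: "real ^ 'n::finite \<Rightarrow> real"
  assumes "finite_measure M" and sets: "sets M = sets borel" and int: "integrable (heat_measure M t) f"
  shows "(LINT x|heat_measure M t. f x) = (LINT x|M. LINT z|gauss_vec. f (x + sqrt (2 * t) *\<^sub>R z))"
proof -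
  interpret finite_measure M by fact
  interpret pair_sigma_finite M gauss_vec ..
  have f: "f \<in> borel_measurable borel"
    using borel_measurable_integrable[OF int] by simp
  have "(LINT x|heat_measure M t. f x) =
      integral\<^sup>L (M \<Otimes>\<^sub>M gauss_vec) (\<lambda>(x, z). f (x + sqrt (2 * t) *\<^sub>R z))"
    unfolding heat_measure_def integral_distr[OF measurable_heat_map[OF sets] f]
    by (simp add: case_prod_unfold)
  also have "\<dots> = (LINT x|M. LINT z|gauss_vec. f (x + sqrt (2 * t) *\<^sub>R z))"
    using integral_fst'[of "\<lambda>(x, z). f (x + sqrt (2 * t) *\<^sub>R z)"] int
    by (simp add: integrable_heat_measure_iff[OF sets f])
  finally show ?thesis .
qed

section \<open>Injectivity of the heat flow on finite measures\<close>

lemma finite_heat_measure: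
  assumes "finite_measure M" and "sets M = sets borel"
  shows "finite_measure (heat_measure M t)"
proof -
  interpret M: finite_measure M by fact
  have "finite_measure (M \<Otimes>\<^sub>M gauss_vec)"
    by (intro finite_measure_pair_measure gauss_vec.finite_measure_axioms assms)
  then show ?thesis
    unfolding heat_measure_def
    by (rule finite_measure.finite_measure_distr) (rule measurable_heat_map[OF assms(2)])
qed

text \<open>For fixed \<open>x\<close> the Gaussian average has frequency
  \<open>sqrt (2 * t) *\<^sub>R a\<close>, half of whose squared norm is
  \<open>t * (norm a)\<^sup>2\<close>. The resulting factor does not depend on \<open>x\<close> and
  leaves the outer integral.\<close>

lemma integral_heat_measure_cos:
  fixes M :: "(real ^ 'n::finite) measure"
  assumes "finite_measure M" and sets: "sets M = sets borel" and t: "0 \<le> t"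
  shows "(LINT x|heat_measure M t. cos (a \<bullet> x + b)) = exp (- t * (norm a)\<^sup>2) * (LINT x|M. cos (a \<bullet> x + b))"
proof -
  interpret H: finite_measure "heat_measure M t"
    by (rule finite_heat_measure[OF assms(1,2)])
  have "integrable (heat_measure M t) (\<lambda>x. cos (a \<bullet> x + b))"
    by (rule H.integrable_const_bound[where B = 1]) auto
  then have "(LINT x|heat_measure M t. cos (a \<bullet> x + b)) =
      (LINT x|M. LINT z|gauss_vec. cos (a \<bullet> (x + sqrt (2 * t) *\<^sub>R z) + b))"
    by (rule integral_heat_measure[OF assms(1,2)])
  also have "\<dots> = (LINT x|M. LINT z|gauss_vec. cos ((a \<bullet> x + b) + (sqrt (2 * t) *\<^sub>R a) \<bullet> z))"
    by (simp add: inner_add_right algebra_simps)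
  also have "\<dots> = exp (- t * (norm a)\<^sup>2) * (LINT x|M. cos (a \<bullet> x + b))"
    using t unfolding integral_gauss_vec_cos by (simp add: power_mult_distrib)
  finally show ?thesis .
qed

lemma heat_measure_inject:
  fixes M N :: "(real ^ 'n::finite) measure"
  assumes "finite_measure M" "finite_measure N" "sets M = sets borel" "sets N = sets borel"
    and "0 \<le> t" and "heat_measure M t = heat_measure N t"
  shows "M = N"
proof (rule finite_measure_eqI_cos[OF assms(1-4)])
  fix a b
  have "exp (- t * (norm a)\<^sup>2) * (LINT x|M. cos (a \<bullet> x + b)) =
      exp (- t * (norm a)\<^sup>2) * (LINT x|N. cos (a \<bullet> x + b))"
    using assms by (simp only: integral_heat_measure_cos[symmetric])
  then show "(LINT x|M. cos (a \<bullet> x + b)) = (LINT x|N. cos (a \<bullet> x + b))"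
    by simp
qed

text \<open>A submultiplicative polynomial majorant: \<open>2 + (a + b)\<^sup>2 \<le> (2 + a\<^sup>2) * (2 + b\<^sup>2)\<close>.\<close>

definition poly_weight :: "real ^ 'n::finite \<Rightarrow> real" where
  "poly_weight x = (\<Prod>j\<in>UNIV. 2 + (x $ j)\<^sup>2)"

lemma poly_weight_ge_1: "1 \<le> poly_weight x"
  unfolding poly_weight_def by (intro prod_ge_1) (simp add: add_increasing2)

lemma real_polynomial_function_nth: "real_polynomial_function (\<lambda>x::real ^ 'n::finite. x $ j)"
  by (rule real_polynomial_function.intros(1)) (rule bounded_linear_vec_nth)

lemma real_polynomial_function_weight: "real_polynomial_function poly_weight"
proof -
  have "real_polynomial_function (\<lambda>x::real ^ 'n. \<Prod>j\<in>UNIV. 2 + (x $ j)\<^sup>2)"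
    by (intro real_polynomial_function_prod real_polynomial_function.intros(2,3)
        real_polynomial_function_power real_polynomial_function_nth) simp
  then show ?thesis by (simp add: poly_weight_def[abs_def])
qed

lemma poly_weight_add: "poly_weight (x + y) \<le> poly_weight x * poly_weight y"
  unfolding poly_weight_def prod.distrib[symmetric]
proof (rule prod_mono, intro conjI)
  fix j
  \<comment> \<open>The cross term of the square is absorbed by the doubled squares on the right.
    With 1 in place of the constant 2 the bound would fail when both coordinates are 1, where it
    would read 5 \<le> 4.\<close>
  have "2 * (x $ j * y $ j) \<le> (x $ j)\<^sup>2 + (y $ j)\<^sup>2"
    using sum_squares_bound[of "x $ j" "y $ j"] by simp
  moreover have "0 \<le> (x $ j)\<^sup>2 * (y $ j)\<^sup>2" by simp
  ultimately show "2 + ((x + y) $ j)\<^sup>2 \<le> (2 + (x $ j)\<^sup>2) * (2 + (y $ j)\<^sup>2)"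
    unfolding vector_add_component power2_sum distrib_left distrib_right by linarith
qed (simp add: add_nonneg_nonneg)

lemma norm_le_poly_weight: "norm x \<le> poly_weight x"
proof -
  \<comment> \<open>The second conjunct strengthens the induction: since the old product is at least
    1, it may multiply the bound for the new coordinate. Splitting 2 as 1 + 1 leaves one more copy
    of that product for the induction hypothesis.\<close>
  have "(\<Sum>j\<in>I. \<bar>x $ j\<bar>) \<le> (\<Prod>j\<in>I. 2 + (x $ j)\<^sup>2) \<and> 1 \<le> (\<Prod>j\<in>I. 2 + (x $ j)\<^sup>2)" if "finite I" for I
    using that
  proof (induction I rule: finite_induct)
    case (insert i I)
    let ?P = "\<Prod>j\<in>I. 2 + (x $ j)\<^sup>2"
    have "0 \<le> (\<bar>x $ i\<bar> - 1)\<^sup>2" by simp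
    then have "\<bar>x $ i\<bar> \<le> 1 + (x $ i)\<^sup>2"
      unfolding power2_diff by simp
    also have "\<dots> * 1 \<le> (1 + (x $ i)\<^sup>2) * ?P"
      using insert.IH by (intro mult_left_mono) (auto simp: add_nonneg_nonneg)
    finally have *: "\<bar>x $ i\<bar> \<le> (1 + (x $ i)\<^sup>2) * ?P" by simp
    moreover have "(2 + (x $ i)\<^sup>2) * ?P = (1 + (x $ i)\<^sup>2) * ?P + ?P"
      by (simp add: algebra_simps)
    ultimately show ?case
      using insert.IH abs_ge_zero[of "x $ i"]
      unfolding sum.insert[OF insert.hyps] prod.insert[OF insert.hyps] by linarith
  qed simp
  then have "(\<Sum>j\<in>UNIV. \<bar>x $ j\<bar>) \<le> poly_weight x"
    by (simp add: poly_weight_def)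
  then show ?thesis using norm_le_l1_cart[of x] by linarith
qed

text \<open>Reduces integrability of all polynomials to that of powers of one submultiplicative
  weight. Sums can share the exponent \<open>m + k\<close> because the weight is at least 1.\<close>

lemma real_polynomial_function_le_weight:
  fixes p :: "real ^ 'n::finite \<Rightarrow> real"
  assumes "real_polynomial_function p"
  shows "\<exists>C m. 0 \<le> C \<and> (\<forall>x. \<bar>p x\<bar> \<le> C * poly_weight x ^ m)"
  using assms
proof (induction p rule: real_polynomial_function.induct)
  case (linear f)
  then obtain K where K: "0 < K" "\<And>x. norm (f x) \<le> norm x * K"
    using bounded_linear.pos_bounded by blast
  have "\<bar>f x\<bar> \<le> K * poly_weight x ^ 1" for x
    using order_trans[OF K(2)[of x] mult_right_mono[OF norm_le_poly_weight less_imp_le[OF K(1)]]]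
    by (simp add: mult.commute)
  then show ?case using K(1) less_imp_le by blast
next
  case (const c)
  have "\<bar>c\<bar> \<le> \<bar>c\<bar> * poly_weight x ^ 0" for x :: "real ^ 'n" by simp
  then show ?case by (meson abs_ge_zero)
next
  case (add f g)
  then obtain C m D k where C: "0 \<le> C" "\<And>x. \<bar>f x\<bar> \<le> C * poly_weight x ^ m"
    and D: "0 \<le> D" "\<And>x. \<bar>g x\<bar> \<le> D * poly_weight x ^ k" by blast
  have "\<bar>f x + g x\<bar> \<le> (C + D) * poly_weight x ^ (m + k)" for x
  proof -
    have "poly_weight x ^ m \<le> poly_weight x ^ (m + k)" "poly_weight x ^ k \<le> poly_weight x ^ (m + k)"
      by (rule power_increasing; simp add: poly_weight_ge_1)+
    then have "C * poly_weight x ^ m \<le> C * poly_weight x ^ (m + k)"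
      "D * poly_weight x ^ k \<le> D * poly_weight x ^ (m + k)"
      using C(1) D(1) by (auto intro: mult_left_mono)
    then show ?thesis
      using C(2)[of x] D(2)[of x] unfolding distrib_right by linarith
  qed
  then show ?case using C(1) D(1) by (meson add_nonneg_nonneg)
next
  case (mult f g)
  then obtain C m D k where C: "0 \<le> C" "\<And>x. \<bar>f x\<bar> \<le> C * poly_weight x ^ m"
    and D: "0 \<le> D" "\<And>x. \<bar>g x\<bar> \<le> D * poly_weight x ^ k" by blast
  have "\<bar>f x * g x\<bar> \<le> (C * D) * poly_weight x ^ (m + k)" for x
  proof -
    have "\<bar>f x\<bar> * \<bar>g x\<bar> \<le> (C * poly_weight x ^ m) * (D * poly_weight x ^ k)"
      using C(2)[of x] D(2)[of x] by (intro mult_mono) (auto intro: order_trans[OF abs_ge_zero])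
    then show ?thesis by (simp add: abs_mult power_add mult_ac)
  qed
  then show ?case using C(1) D(1) by (meson mult_nonneg_nonneg)
qed

section \<open>Integrability of polynomials under the heat flow\<close>

lemma integrable_std_normal_polynomial:
  assumes "real_polynomial_function p"
  shows "integrable std_normal_distribution p"
proof -
  obtain a n where "p = (\<lambda>x. \<Sum>i\<le>n. a i * x ^ i)"
    using real_polynomial_function_imp_sum[OF assms] by (elim exE)
  moreover have "integrable std_normal_distribution (\<lambda>x. \<Sum>i\<le>n. a i * x ^ i)"
    by (intro Bochner_Integration.integrable_sum integrable_mult_right integrable_std_normal_distribution_moment)
  ultimately show ?thesis by (simp only:)
qed

lemma integrable_gauss_vec_weight:
  "integrable gauss_vec (\<lambda>z::real ^ 'n::finite. poly_weight (r *\<^sub>R z) ^ m)"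
proof -
  have "real_polynomial_function (\<lambda>y::real. (2 + (r * y)\<^sup>2) ^ m)"
    by (intro real_polynomial_function_power real_polynomial_function.intros(2,3)
        real_polynomial_function.intros(1) bounded_linear_mult_right)
  then have "integrable gauss_vec (\<lambda>z::real ^ 'n. \<Prod>j\<in>UNIV. (2 + (r * z $ j)\<^sup>2) ^ m)"
    using integrable_gauss_vec_prod[of "\<lambda>_ y. (2 + (r * y)\<^sup>2) ^ m"] integrable_std_normal_polynomial by auto
  then show ?thesis
    by (simp add: poly_weight_def prod_power_distrib)
qed

lemma borel_measurable_real_polynomial_function:
  fixes p :: "'a::euclidean_space \<Rightarrow> real"
  assumes "real_polynomial_function p"
  shows "p \<in> borel_measurable borel"
  by (intro borel_measurable_continuous_onI continuous_on_polymonial_function)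
    (use assms real_polynomial_function_eq in auto)

lemma (in pair_sigma_finite) integrable_mult_pair:
  fixes f :: "_ \<Rightarrow> real"
  assumes f: "integrable M1 f" and g: "integrable M2 g"
  shows "integrable (M1 \<Otimes>\<^sub>M M2) (\<lambda>(x, y). f x * g y)"
proof (rule Fubini_integrable)
  note [measurable] = borel_measurable_integrable[OF f] borel_measurable_integrable[OF g]
  show "(\<lambda>(x, y). f x * g y) \<in> borel_measurable (M1 \<Otimes>\<^sub>M M2)" by measurable
  show "integrable M1 (\<lambda>x. LINT y|M2. norm (case (x, y) of (x, y) \<Rightarrow> f x * g y))"
    using f by (simp add: abs_mult)
  show "AE x in M1. integrable M2 (\<lambda>y. case (x, y) of (x, y) \<Rightarrow> f x * g y)"
    using g by simp
qed

text \<open>Submultiplicativity of the weight separates \<open>x\<close> from \<open>z\<close>: the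
  integrand is dominated by a polynomial in \<open>x\<close>, integrable under \<open>M\<close>,
  times a Gaussian-integrable polynomial in \<open>z\<close>.\<close>

lemma integrable_heat_measure_polynomial:
  fixes M :: "(real ^ 'n::finite) measure"
  assumes "finite_measure M" and sets: "sets M = sets borel"
    and M: "\<And>q. real_polynomial_function q \<Longrightarrow> integrable M q" and p: "real_polynomial_function p"
  shows "integrable (heat_measure M t) p"
proof -
  interpret finite_measure M by fact
  interpret pair_sigma_finite M gauss_vec ..
  note pm = borel_measurable_real_polynomial_function[OF p]
  let ?r = "sqrt (2 * t)"
  obtain C m where C: "0 \<le> C" and le: "\<And>x. \<bar>p x\<bar> \<le> C * poly_weight x ^ m"
    using real_polynomial_function_le_weight[OF p] by blast
  have "integrable (M \<Otimes>\<^sub>M gauss_vec) (\<lambda>(x, z). (C * poly_weight x ^ m) * poly_weight (?r *\<^sub>R z) ^ m)"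
    by (intro integrable_mult_pair integrable_gauss_vec_weight integrable_mult_right M
        real_polynomial_function_power real_polynomial_function_weight)
  then have "integrable (M \<Otimes>\<^sub>M gauss_vec) (\<lambda>(x, z). p (x + ?r *\<^sub>R z))"
  proof (rule Bochner_Integration.integrable_bound)
    show "(\<lambda>(x, z). p (x + ?r *\<^sub>R z)) \<in> borel_measurable (M \<Otimes>\<^sub>M gauss_vec)"
      using measurable_compose[OF measurable_heat_map[OF sets] pm, of ?r] by (simp add: case_prod_unfold)
    have "\<bar>p (x + ?r *\<^sub>R z)\<bar> \<le> C * poly_weight x ^ m * poly_weight (?r *\<^sub>R z) ^ m" for x z
    proof -
      have "poly_weight (x + ?r *\<^sub>R z) ^ m \<le> (poly_weight x * poly_weight (?r *\<^sub>R z)) ^ m"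
        by (rule power_mono[OF poly_weight_add]) (rule order_trans[OF zero_le_one poly_weight_ge_1])
      from mult_left_mono[OF this C] le[of "x + ?r *\<^sub>R z"] show ?thesis
        by (simp add: power_mult_distrib)
    qed
    then show "AE p' in M \<Otimes>\<^sub>M gauss_vec. norm (case p' of (x, z) \<Rightarrow> p (x + ?r *\<^sub>R z)) \<le>
        norm (case p' of (x, z) \<Rightarrow> C * poly_weight x ^ m * poly_weight (?r *\<^sub>R z) ^ m)"
      by (intro AE_I2) (auto intro: order_trans[OF _ abs_ge_self])
  qed
  then show ?thesis by (simp add: integrable_heat_measure_iff[OF sets pm])
qed

subsection \<open>Heat polynomials and moments\<close>

text \<open>The classical heat polynomial, a rescaled Hermite polynomial, read as a polynomial in
  the time with the position \<open>a\<close> as a parameter.\<close>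

definition heat_poly :: "nat \<Rightarrow> real \<Rightarrow> real poly" where
  "heat_poly k a = (\<Sum>m\<le>k div 2. monom (fact k / (fact (k - 2 * m) * fact m) * a ^ (k - 2 * m)) m)"

lemma coeff_heat_poly:
  "coeff (heat_poly k a) m = (if 2 * m \<le> k then fact k / (fact (k - 2 * m) * fact m) * a ^ (k - 2 * m) else 0)"
proof -
  have "m \<le> k div 2 \<longleftrightarrow> 2 * m \<le> k" by auto
  then show ?thesis
    by (simp add: heat_poly_def coeff_sum)
qed

lemma degree_heat_poly: "degree (heat_poly k a) \<le> k"
  by (rule degree_le) (auto simp: coeff_heat_poly)

lemma poly_heat_poly_0: "poly (heat_poly k a) 0 = a ^ k"
  by (simp add: poly_0_coeff_0 coeff_heat_poly)

lemma pderiv_heat_poly: "pderiv (heat_poly k a) = smult (real (k * (k - 1))) (heat_poly (k - 2) a)"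
proof (rule poly_eqI)
  fix m
  show "coeff (pderiv (heat_poly k a)) m = coeff (smult (real (k * (k - 1))) (heat_poly (k - 2) a)) m"
  proof (cases "2 * Suc m \<le> k")
    case True
    then obtain l where k: "k = Suc (Suc (2 * m + l))"
      by (metis add_Suc le_Suc_ex mult_Suc_right numeral_2_eq_2 plus_1_eq_Suc add.assoc add.left_commute add_2_eq_Suc)
    show ?thesis
      unfolding coeff_pderiv coeff_smult coeff_heat_poly k
      by (simp add: fact_Suc divide_simps del: of_nat_Suc) (simp add: algebra_simps)
  next
    case False
    \<comment> \<open>For \<open>k \<le> 1\<close> the truncated index \<open>k - 2\<close> is 0 and
      \<open>heat_poly 0 a\<close> is the constant 1; there it is the factor
      \<open>k * (k - 1)\<close> that vanishes.\<close>
    then have "\<not> 2 * m \<le> k - 2 \<or> k * (k - 1) = 0" by (cases "k \<le> 1") (auto simp: le_Suc_eq)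
    with False show ?thesis
      unfolding coeff_pderiv coeff_smult coeff_heat_poly by auto
  qed
qed

text \<open>In the binomial expansion the odd Gaussian moments vanish. The moment of order
  \<open>2 * m\<close> is \<open>fact (2 * m) / (2 ^ m * fact m)\<close>; its power of 2 cancels
  against \<open>(2 * t) ^ m\<close>, and \<open>fact (2 * m)\<close> against the binomial
  coefficient.\<close>

lemma integral_std_normal_heat_poly:
  assumes "0 \<le> t"
  shows "(LINT z|std_normal_distribution. (a + sqrt (2 * t) * z) ^ k) = poly (heat_poly k a) t"
proof -
  let ?r = "sqrt (2 * t)"
  let ?m = "\<lambda>i. LINT z|std_normal_distribution. z ^ i"
  let ?g = "\<lambda>i. (of_nat (k choose i) * ?r ^ i * a ^ (k - i)) * ?m i"
  have "(LINT z|std_normal_distribution. (a + ?r * z) ^ k) =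
      (LINT z|std_normal_distribution. (\<Sum>i\<le>k. (of_nat (k choose i) * ?r ^ i * a ^ (k - i)) * z ^ i))"
    by (simp only: add.commute[of a] binomial_ring power_mult_distrib mult_ac)
  also have "\<dots> = (\<Sum>i\<le>k. ?g i)"
    by (subst Bochner_Integration.integral_sum)
      (auto intro!: integrable_mult_right integrable_std_normal_distribution_moment)
  also have "\<dots> = (\<Sum>i\<in>(\<lambda>m. 2 * m) ` {..k div 2}. ?g i)"
  proof (rule sum.mono_neutral_right)
    show "\<forall>i\<in>{..k} - (\<lambda>m. 2 * m) ` {..k div 2}. ?g i = 0"
    proof
      fix i assume i: "i \<in> {..k} - (\<lambda>m. 2 * m) ` {..k div 2}"
      have "odd i"
      proof
        assume "even i"
        then obtain m where "i = 2 * m" by blast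
        then show False using i by auto
      qed
      then show "?g i = 0"
        by (simp add: integral_std_normal_distribution_moment_odd)
    qed
  qed auto
  also have "\<dots> = (\<Sum>m\<le>k div 2. ?g (2 * m))"
    by (subst sum.reindex) (auto simp: inj_on_def)
  also have "\<dots> = (\<Sum>m\<le>k div 2. fact k / (fact (k - 2 * m) * fact m) * a ^ (k - 2 * m) * t ^ m)"
  proof (rule sum.cong[OF refl])
    fix m assume "m \<in> {..k div 2}"
    then have m: "2 * m \<le> k" by auto
    have "?r ^ (2 * m) = 2 ^ m * t ^ m"
      using assms by (simp add: power_mult power_mult_distrib)
    then show "?g (2 * m) = fact k / (fact (k - 2 * m) * fact m) * a ^ (k - 2 * m) * t ^ m"
      unfolding std_normal_distribution_even_moments(1) binomial_fact[OF m, where 'a = real]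
      by (simp only:) (simp add: field_simps)
  qed
  also have "\<dots> = poly (heat_poly k a) t"
    by (simp add: heat_poly_def poly_sum poly_monom)
  finally show ?thesis .
qed

section \<open>Heat polynomials in several variables\<close>

definition heat_monomial :: "('n::finite \<Rightarrow> nat) \<Rightarrow> real ^ 'n \<Rightarrow> real poly" where
  "heat_monomial \<alpha> x = (\<Prod>j\<in>UNIV. heat_poly (\<alpha> j) (x $ j))"

lemma degree_heat_monomial: "degree (heat_monomial \<alpha> x) \<le> (\<Sum>j\<in>UNIV. \<alpha> j)"
proof -
  have "degree (heat_monomial \<alpha> x) \<le> (\<Sum>j\<in>UNIV. degree (heat_poly (\<alpha> j) (x $ j)))"
    using degree_prod_sum_le[of UNIV "\<lambda>j. heat_poly (\<alpha> j) (x $ j)"] by (simp add: heat_monomial_def o_def)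
  also have "\<dots> \<le> (\<Sum>j\<in>UNIV. \<alpha> j)"
    by (intro sum_mono degree_heat_poly)
  finally show ?thesis .
qed

lemma poly_heat_monomial_0: "poly (heat_monomial \<alpha> x) 0 = monomial \<alpha> x"
  by (simp add: heat_monomial_def monomial_def poly_prod poly_heat_poly_0)

text \<open>The product rule: differentiating the factor of coordinate \<open>j\<close> lowers its
  index by 2. Thus the moment recursion already holds pointwise in \<open>x\<close>, before any
  integration.\<close>

lemma pderiv_heat_monomial:
  "pderiv (heat_monomial \<alpha> x) =
    (\<Sum>j\<in>UNIV. smult (real (\<alpha> j * (\<alpha> j - 1))) (heat_monomial (\<alpha>(j := \<alpha> j - 2)) x))"
  unfolding heat_monomial_def pderiv_prod
proof (rule sum.cong[OF refl])
  fix j :: 'a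
  have "(\<Prod>i\<in>UNIV. heat_poly ((\<alpha>(j := \<alpha> j - 2)) i) (x $ i)) =
      heat_poly (\<alpha> j - 2) (x $ j) * (\<Prod>i\<in>UNIV - {j}. heat_poly (\<alpha> i) (x $ i))"
    by (simp add: prod.remove[of UNIV j])
  then show "(\<Prod>i\<in>UNIV - {j}. heat_poly (\<alpha> i) (x $ i)) * pderiv (heat_poly (\<alpha> j) (x $ j)) =
      smult (real (\<alpha> j * (\<alpha> j - 1))) (\<Prod>i\<in>UNIV. heat_poly ((\<alpha>(j := \<alpha> j - 2)) i) (x $ i))"
    by (simp only: pderiv_heat_poly mult_smult_right mult.commute)
qed

text \<open>Needed to integrate over \<open>x\<close> coefficient by coefficient in the time
  variable.\<close>

lemma real_polynomial_function_coeff_heat_monomial: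
  fixes \<alpha> :: "'n::finite \<Rightarrow> nat"
  shows "real_polynomial_function (\<lambda>x. coeff (heat_monomial \<alpha> x) i)"
proof -
  have single: "real_polynomial_function (\<lambda>x::real ^ 'n. coeff (heat_poly k (x $ j)) i)" for k j i
    unfolding coeff_heat_poly
    by (cases "2 * i \<le> k") (simp_all only: if_True if_False,
      intro real_polynomial_function.intros(2,4) real_polynomial_function_power real_polynomial_function_nth,
      rule real_polynomial_function.intros(2))
  have "real_polynomial_function (\<lambda>x::real ^ 'n. coeff (\<Prod>j\<in>J. heat_poly (\<alpha> j) (x $ j)) i)"
    if "finite J" for J
    using that
  proof (induction J arbitrary: i rule: finite_induct)
    case empty
    show ?case unfolding prod.empty by (rule real_polynomial_function.intros(2))
  next
    case (insert j J)
    show ?case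
      unfolding prod.insert[OF insert.hyps] coeff_mult
      by (intro real_polynomial_function_sum real_polynomial_function.intros(4) single insert.IH) simp
  qed
  then show ?thesis by (simp add: heat_monomial_def)
qed

section \<open>Moments of the evolved measure\<close>

lemma representing_measure_finite:
  assumes "representing_measure s M"
  shows "finite_measure M"
proof -
  have "integrable M (\<lambda>_. 1 :: real)"
    using assms real_polynomial_function.intros(2)[of 1] unfolding representing_measure_def by blast
  then show ?thesis
    by (auto intro!: finite_measureI simp: integrable_iff_bounded less_top)
qed

text \<open>Integration is linear, so integrating the coefficients of \<open>heat_monomial\<close>
  preserves the recursion and turns the initial values into the moments \<open>s\<close>. Uniqueness
  of the family then identifies the result.\<close>

lemma heat_moments_eq_integral:
  fixes s :: "('n::finite \<Rightarrow> nat) \<Rightarrow> real"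
  assumes "representing_measure s M"
  shows "heat_moments s t \<alpha> = (LINT x|M. poly (heat_monomial \<alpha> x) t)"
proof -
  have int: "integrable M (\<lambda>x. coeff (heat_monomial \<beta> x) i)" for \<beta> i
    using assms real_polynomial_function_coeff_heat_monomial unfolding representing_measure_def by blast
  \<comment> \<open>The degree bound is uniform in \<open>x\<close>, so the integrated coefficients
    again form a polynomial.\<close>
  define p where "p \<beta> = (\<Sum>i\<le>(\<Sum>j\<in>UNIV. \<beta> j). monom (LINT x|M. coeff (heat_monomial \<beta> x) i) i)" for \<beta>
  have coeff_p: "coeff (p \<beta>) i = (LINT x|M. coeff (heat_monomial \<beta> x) i)" for \<beta> i
  proof (cases "i \<le> (\<Sum>j\<in>UNIV. \<beta> j)")
    case False
    then have "coeff (heat_monomial \<beta> x) i = 0" for x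
      using degree_heat_monomial[of \<beta> x] by (intro coeff_eq_0) linarith
    then show ?thesis using False by (simp add: p_def coeff_sum)
  qed (simp add: p_def coeff_sum)
  have "heat_moment_family s p"
    unfolding heat_moment_family_def
  proof (intro allI conjI)
    fix \<beta>
    show "poly (p \<beta>) 0 = s \<beta>"
      using assms by (simp add: poly_0_coeff_0 coeff_p poly_heat_monomial_0[unfolded poly_0_coeff_0]
          representing_measure_def)
    show "pderiv (p \<beta>) = (\<Sum>j\<in>UNIV. smult (real (\<beta> j * (\<beta> j - 1))) (p (\<beta>(j := \<beta> j - 2))))"
    proof (rule poly_eqI)
      fix i
      have "coeff (pderiv (p \<beta>)) i = (LINT x|M. coeff (pderiv (heat_monomial \<beta> x)) i)"
        unfolding coeff_pderiv coeff_p by (rule integral_mult_right_zero[symmetric])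
      also have "\<dots> = (LINT x|M. (\<Sum>j\<in>UNIV. real (\<beta> j * (\<beta> j - 1)) * coeff (heat_monomial (\<beta>(j := \<beta> j - 2)) x) i))"
        unfolding pderiv_heat_monomial coeff_sum coeff_smult ..
      also have "\<dots> = (\<Sum>j\<in>UNIV. real (\<beta> j * (\<beta> j - 1)) * coeff (p (\<beta>(j := \<beta> j - 2))) i)"
        unfolding coeff_p by (subst Bochner_Integration.integral_sum) (auto intro: integrable_mult_right int)
      finally show "coeff (pderiv (p \<beta>)) i =
          coeff (\<Sum>j\<in>UNIV. smult (real (\<beta> j * (\<beta> j - 1))) (p (\<beta>(j := \<beta> j - 2)))) i"
        by (simp only: coeff_sum coeff_smult)
    qed
  qed
  then have "heat_moment_poly s = p"
    using heat_moment_family_unique heat_moment_family_poly by blast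
  then have "heat_moments s t \<alpha> = (\<Sum>i\<le>(\<Sum>j\<in>UNIV. \<alpha> j). LINT x|M. coeff (heat_monomial \<alpha> x) i * t ^ i)"
    by (simp add: heat_moments_def p_def poly_sum poly_monom)
  also have "\<dots> = (LINT x|M. (\<Sum>i\<le>(\<Sum>j\<in>UNIV. \<alpha> j). coeff (heat_monomial \<alpha> x) i * t ^ i))"
    by (rule Bochner_Integration.integral_sum[symmetric]) (intro integrable_mult_left int)
  also have "\<dots> = (LINT x|M. poly (heat_monomial \<alpha> x) t)"
  proof (rule Bochner_Integration.integral_cong[OF refl])
    fix x
    show "(\<Sum>i\<le>(\<Sum>j\<in>UNIV. \<alpha> j). coeff (heat_monomial \<alpha> x) i * t ^ i) = poly (heat_monomial \<alpha> x) t"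
      using arg_cong[OF poly_as_sum_of_monoms'[OF degree_heat_monomial[of \<alpha> x]], of "\<lambda>q. poly q t"]
      by (simp add: poly_sum poly_monom)
  qed
  finally show ?thesis .
qed

text \<open>By Fubini, the Gaussian average is taken first with \<open>x\<close> fixed. It factors
  over the coordinates into one-dimensional averages, whose product is \<open>heat_monomial\<close>
  at time \<open>t\<close>.\<close>

lemma representing_measure_heat_measure:
  fixes s :: "('n::finite \<Rightarrow> nat) \<Rightarrow> real"
  assumes M: "representing_measure s M" and t: "0 \<le> t"
  shows "representing_measure (heat_moments s t) (heat_measure M t)"
proof -
  note fin = representing_measure_finite[OF M]
  have sets: "sets M = sets borel" and int: "\<And>q. real_polynomial_function q \<Longrightarrow> integrable M q"
    using M by (auto simp: representing_measure_def)
  note int' = integrable_heat_measure_polynomial[OF fin sets int]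
  have "heat_moments s t \<alpha> = (LINT x|heat_measure M t. monomial \<alpha> x)" for \<alpha>
  proof -
    have inner: "(LINT z|gauss_vec. monomial \<alpha> (x + sqrt (2 * t) *\<^sub>R z)) = poly (heat_monomial \<alpha> x) t" for x
    proof -
      have "integrable std_normal_distribution (\<lambda>z. (x $ j + sqrt (2 * t) * z) ^ \<alpha> j)" for j
        by (intro integrable_std_normal_polynomial real_polynomial_function_power
            real_polynomial_function.intros(2,3) real_polynomial_function.intros(1) bounded_linear_mult_right)
      from integral_gauss_vec_prod[OF this] show ?thesis
        by (simp add: monomial_def heat_monomial_def poly_prod integral_std_normal_heat_poly[OF t])
    qed
    have "real_polynomial_function (monomial \<alpha> :: real ^ 'n \<Rightarrow> real)"
      unfolding monomial_def[abs_def]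
      by (intro real_polynomial_function_prod real_polynomial_function_power real_polynomial_function_nth) simp
    then have "(LINT x|heat_measure M t. monomial \<alpha> x) =
        (LINT x|M. LINT z|gauss_vec. monomial \<alpha> (x + sqrt (2 * t) *\<^sub>R z))"
      by (intro integral_heat_measure[OF fin sets] int')
    then show ?thesis
      by (simp only: inner heat_moments_eq_integral[OF M])
  qed
  then show ?thesis
    using int' by (simp add: representing_measure_def)
qed

theorem theorem2p23:
  fixes s :: "('n::finite \<Rightarrow> nat) \<Rightarrow> real"
  assumes "indeterminate s"
  shows "\<forall>t\<in>{0..}. indeterminate (heat_moments s t)"
proof
  fix t :: real
  assume "t \<in> {0..}"
  then have t: "0 \<le> t" by simp
  obtain M N where M: "representing_measure s M" and N: "representing_measure s N" and "M \<noteq> N"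
    using assms unfolding indeterminate_def moment_sequence_def determinate_def by blast
  note rep = representing_measure_heat_measure[OF M t] representing_measure_heat_measure[OF N t]
  have "heat_measure M t \<noteq> heat_measure N t"
    using heat_measure_inject[OF representing_measure_finite[OF M] representing_measure_finite[OF N] _ _ t] M N
      \<open>M \<noteq> N\<close> by (auto simp: representing_measure_def)
  with rep show "indeterminate (heat_moments s t)"
    unfolding indeterminate_def moment_sequence_def determinate_def by blast
qed

end
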